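(* Let $(E,e)$ be a pointed Archimedean vector lattice, i.e. $E$ is an Archimedean vector lattice and $e\in E$. Then $(E,e)$ is square closed if and only if $E$ is a $\Phi$-algebra with multiplicative unit $e$. More precisely: (a) If $(E,e)$ is square closed, then the product on $E$ defined by $$fg:=\tfrac12\Bigl((f+g)^{[2]}-\bigl(f^{[2]}+g^{[2]}\bigr)\Bigr)\qquad (f,g\in E)$$ satisfies each of the following: (i) $f(g+h)=fg+fh$ for all $f,g,h\in E$; (ii) $(f+g)h=fh+gh$ for all $f,g,h\in E$; (iii) $(fg)h=f(gh)$ for all $f,g,h\in E$; (iv) $(\alpha f)(\beta g)=(\alpha\beta)fg$ for all $f,g\in E$ and $\alpha,\beta\in\mathbb{R}$; (v) if $f,g\in E^+$, then $fg\in E^+$; (vi) if $f,g\in E$ satisfy $f\wedge g=0$, and $c\in E^+$, then $(cf)\wedge g=0$; (vii) if $f,g\in E$ satisfy $f\wedge g=0$, and $c\in E^+$, then $(fc)\wedge g=0$; (viii) $fe=f$ for all $f\in E$; (ix) $ef=f$ for all $f\in E$. (b) Conversely, if there is a map $E\times E\ni(f,g)\mapsto fg\in E$ satisfying (i)–(ix), then $(E,e)$ is square closed. Furthermore, in this case $f^2=f^{[2]}$ for every $f\in E$, where $f^2:=ff$.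
   Context: All vector lattices are real; $E^+$ is the positive cone of $E$. For a vector lattice $E$, an element $e\in E$ and $f\in E$, if the supremum $\sup_{\lambda\in\mathbb{R}}\{2\lambda f-\lambda^2e\}$ exists in $E$, it is denoted $f^{[2]}$ (the order-theoretic square of $f$ with respect to $e$), and one says that $f^{[2]}$ exists in $E$. The pair $(E,e)$ is called square closed if $f^{[2]}$ exists in $E$ for every $f\in E$. A $\Phi$-algebra with multiplicative unit $e$ is a vector lattice $E$ equipped with a map $E\times E\to E$, $(f,g)\mapsto fg$, satisfying (i)–(ix) of the claim. *)

theory Defs
  imports Complex_Main "HOL-Library.Lub_Glb"
begin

class vector_lattice = ordered_real_vector + lattice

text \<open>For \<open>u \<ge> 0\<close>, the infimum of \<open>{u/n | n \<ge> 1}\<close> is \<open>0\<close>; that \<open>0\<close> is a lower bound is automatic.\<close>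

class archimedean_vector_lattice = vector_lattice +
  assumes archimedean:
    "0 \<le> u \<Longrightarrow> (\<And>n::nat. 1 \<le> n \<Longrightarrow> y \<le> inverse (real n) *\<^sub>R u) \<Longrightarrow> y \<le> 0"

instance real :: vector_lattice ..

instance real :: archimedean_vector_lattice
proof
  fix u y :: real
  assume y: "\<And>n::nat. 1 \<le> n \<Longrightarrow> y \<le> inverse (real n) *\<^sub>R u"
  have "(\<lambda>n. inverse (real (Suc n)) * u) \<longlonglongrightarrow> 0 * u"
    by (intro tendsto_mult LIMSEQ_inverse_real_of_nat tendsto_const)
  then have "(\<lambda>n. inverse (real (Suc n)) * u) \<longlonglongrightarrow> 0"
    by simp
  moreover have "y \<le> inverse (real (Suc n)) * u" for n
    using y[of "Suc n"] by simp
  ultimately show "y \<le> 0"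
    by (intro LIMSEQ_le_const) auto
qed

lemma isGlb_inverse_nat:
  fixes u :: "'a::archimedean_vector_lattice"
  assumes "0 \<le> u"
  shows "isGlb UNIV {inverse (real n) *\<^sub>R u | n. 1 \<le> n} 0"
  using assms archimedean[OF assms]
  by (auto simp: isGlb_def greatestP_def isLb_def setge_def setle_def intro!: scaleR_nonneg_nonneg)

definition has_osquare :: "'a::vector_lattice \<Rightarrow> 'a \<Rightarrow> 'a \<Rightarrow> bool" where
  "has_osquare e f s \<longleftrightarrow>
     isLub UNIV (range (\<lambda>l::real. (2 * l) *\<^sub>R f - l\<^sup>2 *\<^sub>R e)) s"

text \<open>The value is meaningful only if the supremum exists; it is then unique.\<close>

definition osquare :: "'a::vector_lattice \<Rightarrow> 'a \<Rightarrow> 'a" where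
  "osquare e f = (THE s. has_osquare e f s)"

lemma osquare_eq: "has_osquare e f s \<Longrightarrow> osquare e f = s"
  unfolding osquare_def has_osquare_def
  by (rule the_equality)
     (auto simp: isLub_def leastP_def isUb_def setge_def intro: order.antisym)

definition square_closed :: "'a::vector_lattice \<Rightarrow> bool" where
  "square_closed e \<longleftrightarrow> (\<forall>f. \<exists>s. has_osquare e f s)"

definition osprod :: "'a::vector_lattice \<Rightarrow> 'a \<Rightarrow> 'a \<Rightarrow> 'a" where
  "osprod e f g = (1/2) *\<^sub>R (osquare e (f + g) - (osquare e f + osquare e g))"

locale phi_algebra =
  fixes mult :: "'a::vector_lattice \<Rightarrow> 'a \<Rightarrow> 'a" (infixl \<open>\<odot>\<close> 70)
    and e :: 'a
  assumes distrib_left: "f \<odot> (g + h) = f \<odot> g + f \<odot> h"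
    and distrib_right: "(f + g) \<odot> h = f \<odot> h + g \<odot> h"
    and assoc: "(f \<odot> g) \<odot> h = f \<odot> (g \<odot> h)"
    and scaleR_mult: "(a *\<^sub>R f) \<odot> (b *\<^sub>R g) = (a * b) *\<^sub>R (f \<odot> g)"
    and mult_nonneg: "0 \<le> f \<Longrightarrow> 0 \<le> g \<Longrightarrow> 0 \<le> f \<odot> g"
    and mult_left_disjoint: "inf f g = 0 \<Longrightarrow> 0 \<le> c \<Longrightarrow> inf (c \<odot> f) g = 0"
    and mult_right_disjoint: "inf f g = 0 \<Longrightarrow> 0 \<le> c \<Longrightarrow> inf (f \<odot> c) g = 0"
    and unit_right: "f \<odot> e = f"
    and unit_left: "e \<odot> f = f"

end

theory Submission
  imports Defs "HOL-Library.Lattice_Algebras"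
begin

text \<open>
  Substituting \<open>\<lambda> = \<alpha> + \<beta>\<close>, \<open>\<mu> = \<alpha> - \<beta>\<close> in the defining suprema gives the parallelogram law for
  \<open>f\<^sup>[\<^sup>2\<^sup>]\<close>, hence biadditivity of the polarised product; positivity comes from monotonicity of the
  square in \<open>|f|\<close>, and real homogeneity from positivity and the Archimedean property.
  Unbounded elements are controlled by \<open>c \<le> n e + c\<^sup>[\<^sup>2\<^sup>] / n\<close>, which yields \<open>cf \<and> g = 0\<close> for
  disjoint \<open>f\<close>, \<open>g\<close>.

  Associativity and the converse both rest on one approximation argument: if \<open>Q\<close> preserves finite
  infima of positive elements and \<open>v \<le> Q |x - te|\<close> for all \<open>t \<ge> 0\<close>, then letting \<open>t\<close> run through a
  finite grid makes the infimum of the \<open>|x - te|\<close> arbitrarily small, so \<open>v \<le> 0\<close>.  For associativity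
  \<open>Q y = f(gy) + (fg)y\<close> and \<open>v = f(gx) - (fg)x\<close>, which is unchanged when \<open>x\<close> is replaced by
  \<open>x - te\<close>; for the converse \<open>Q y = y\<^sup>2\<close> and \<open>v = f\<^sup>2 - u\<close> with \<open>u\<close> an upper bound of the
  \<open>2tf - t\<^sup>2e\<close>.
\<close>

subclass (in vector_lattice) lattice_ab_group_add ..

section \<open>Vector lattices\<close>

lemma eq_pprt_diff:
  fixes x :: "'a::lattice_ab_group_add"
  shows "x = pprt x - pprt (- x)"
  using prts[of x] by (simp add: pprt_neg)

text \<open>Since \<open>pprt x = x + pprt (- x)\<close>, translation by \<open>pprt (- x)\<close>
  turns the infimum into \<open>inf x 0 + pprt (- x)\<close>, and these terms are
  \<open>nprt x\<close> and \<open>- nprt x\<close>.\<close>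

lemma inf_pprt_pprt_minus:
  fixes x :: "'a::lattice_ab_group_add"
  shows "inf (pprt x) (pprt (- x)) = 0"
proof -
  have "inf (pprt x) (pprt (- x)) = inf x 0 + pprt (- x)"
    by (metis add.left_neutral add_inf_distrib_right diff_add_cancel eq_pprt_diff)
  then show ?thesis
    by (simp add: pprt_neg flip: nprt_def)
qed

lemma le_pprt: "(x::'a::lattice_ab_group_add) \<le> pprt x"
  by (simp add: pprt_def)

lemma sup_minus_nonneg: "0 \<le> sup x (- (x::'a::lattice_ab_group_add))"
proof -
  have "x + - x \<le> sup x (- x) + sup x (- x)"
    by (intro add_mono) simp_all
  then show ?thesis by simp
qed

text \<open>The left side is the modulus |x|. A sum is infimum plus supremum, so disjoint parts add
  up to their supremum.\<close>

lemma sup_minus_eq_pprt: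
  fixes x :: "'a::lattice_ab_group_add"
  shows "sup x (- x) = pprt x + pprt (- x)"
proof -
  have "pprt x + pprt (- x) = sup (pprt x) (pprt (- x))"
    using add_eq_inf_sup[of "pprt x" "pprt (- x)"] by (simp add: inf_pprt_pprt_minus)
  also have "\<dots> = sup (sup x (- x)) 0"
    by (simp add: pprt_def sup_aci)
  also have "\<dots> = sup x (- x)"
    by (rule sup_absorb1[OF sup_minus_nonneg])
  finally show ?thesis ..
qed

section \<open>Disjointness\<close>

lemma disjoint_nonneg:
  fixes a b :: "'a::lattice_ab_group_add"
  assumes "inf a b = 0"
  shows "0 \<le> a" "0 \<le> b"
  using assms by (metis inf_le1, metis inf_le2)

lemma disjoint_antimono:
  fixes a b c :: "'a::lattice_ab_group_add"
  assumes "inf a c = 0" "0 \<le> b" "b \<le> a"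
  shows "inf b c = 0"
  using assms disjoint_nonneg[OF assms(1)]
  by (metis inf_mono le_inf_iff order.antisym order.refl)

text \<open>Distributivity writes the right side as the infimum of \<open>a + b\<close>,
  \<open>a + c\<close>, \<open>c + b\<close> and \<open>c + c\<close>; each of them dominates the
  left side.\<close>

lemma inf_add_le:
  fixes a b c :: "'a::lattice_ab_group_add"
  assumes "0 \<le> a" "0 \<le> b" "0 \<le> c"
  shows "inf (a + b) c \<le> inf a c + inf b c"
proof -
  have "inf (a + b) c \<le> a + b" "inf (a + b) c \<le> c"
    by simp_all
  moreover have "c \<le> a + c" "c \<le> c + b" "c \<le> c + c"
    using assms by simp_all
  ultimately have "inf (a + b) c \<le> inf (inf (a + b) (c + b)) (inf (a + c) (c + c))"
    by (meson le_inf_iff order.trans)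
  then show ?thesis
    by (simp add: add_inf_distrib_left add_inf_distrib_right)
qed

lemma disjoint_add:
  fixes a b c :: "'a::lattice_ab_group_add"
  assumes "inf a c = 0" "inf b c = 0"
  shows "inf (a + b) c = 0"
  using inf_add_le[of a b c] assms disjoint_nonneg[OF assms(1)] disjoint_nonneg[OF assms(2)]
  by (intro order.antisym) auto

lemma inf_diff_disjoint:
  fixes a b :: "'a::lattice_ab_group_add"
  shows "inf (a - inf a b) (b - inf a b) = 0"
  using add_inf_distrib_right[of a b "- inf a b"] by (simp del: neg_inf_eq_sup diff_inf_eq_sup)

lemma disjoint_scaleR_left:
  fixes a b :: "'a::vector_lattice"
  assumes "inf a b = 0" "0 \<le> r"
  shows "inf (r *\<^sub>R a) b = 0"
proof -
  have a: "0 \<le> a" and b: "0 \<le> b"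
    using disjoint_nonneg[OF assms(1)] .
  have n: "inf (real n *\<^sub>R a) b = 0" for n
  proof (induction n)
    case 0
    then show ?case using b by (simp add: inf_absorb1)
  next
    case (Suc n)
    then show ?case
      using disjoint_add[OF assms(1) Suc] by (simp add: scaleR_left_distrib)
  qed
  obtain n where "r \<le> real n"
    using real_arch_simple by blast
  then show ?thesis
    using disjoint_antimono[OF n[of n]] a assms(2)
    by (simp add: scaleR_nonneg_nonneg scaleR_right_mono)
qed

section \<open>Archimedean estimates and additive maps\<close>

lemma archimedean_le_zero:
  fixes u v :: "'a::archimedean_vector_lattice"
  assumes "0 \<le> u" "\<And>n::nat. 1 \<le> n \<Longrightarrow> v \<le> (1 / real n) *\<^sub>R u"
  shows "v \<le> 0"
  using archimedean[OF assms(1), of v] assms(2) by (simp add: inverse_eq_divide)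

text \<open>Additivity handles integer factors, positivity permits rounding a real factor to an
  integer, and the Archimedean property removes the rounding error.\<close>

lemma positive_additive_scaleR:
  fixes T :: "'a::vector_lattice \<Rightarrow> 'b::archimedean_vector_lattice"
  assumes add: "\<And>x y. T (x + y) = T x + T y" and pos: "\<And>x. 0 \<le> x \<Longrightarrow> 0 \<le> T x"
  shows "T (r *\<^sub>R x) = r *\<^sub>R T x"
proof -
  have zero: "T 0 = 0"
    using add[of 0 0] by simp
  have neg: "T (- y) = - T y" for y
    using add[of y "- y"] zero by (simp add: eq_neg_iff_add_eq_0 add.commute)
  have diff: "T (y - z) = T y - T z" for y z
    using add[of y "- z"] neg by simp
  have nat: "T (real n *\<^sub>R y) = real n *\<^sub>R T y" for n y
    by (induction n) (simp_all add: zero add scaleR_left_distrib)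
  have int: "T (real_of_int k *\<^sub>R y) = real_of_int k *\<^sub>R T y" for k y
    by (cases k rule: int_cases2) (simp_all add: nat neg)
  have mono: "T y \<le> T z" if "y \<le> z" for y z
    using pos[of "z - y"] that by (simp add: diff)
  have upper: "T (r *\<^sub>R y) - r *\<^sub>R T y \<le> 0" if y: "0 \<le> y" for r y
  proof (rule archimedean_le_zero)
    show "0 \<le> T y" using pos y .
    fix n :: nat
    assume n: "1 \<le> n"
    \<comment> \<open>Rounding up adds less than 1 to \<open>real n * r\<close>, so after division
      by \<open>n\<close> the defect is at most \<open>T y / n\<close>.\<close>
    define k where "k = \<lceil>real n * r\<rceil>"
    have k: "real n * r \<le> real_of_int k" "real_of_int k \<le> real n * r + 1"
      unfolding k_def by linarith+
    have "real n *\<^sub>R T (r *\<^sub>R y) = T ((real n * r) *\<^sub>R y)"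
      by (simp flip: nat)
    also have "\<dots> \<le> T (real_of_int k *\<^sub>R y)"
      by (intro mono scaleR_right_mono k y)
    also have "\<dots> \<le> (real n * r + 1) *\<^sub>R T y"
      unfolding int by (intro scaleR_right_mono k pos y)
    finally have "real n *\<^sub>R (T (r *\<^sub>R y) - r *\<^sub>R T y) \<le> T y"
      by (simp add: algebra_simps)
    then have "(1 / real n) *\<^sub>R (real n *\<^sub>R (T (r *\<^sub>R y) - r *\<^sub>R T y)) \<le> (1 / real n) *\<^sub>R T y"
      by (rule scaleR_left_mono) simp
    then show "T (r *\<^sub>R y) - r *\<^sub>R T y \<le> (1 / real n) *\<^sub>R T y"
      using n by simp
  qed
  \<comment> \<open>As \<open>T\<close> is odd, the bound for \<open>- r\<close> is the reverse
    inequality for \<open>r\<close>.\<close>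
  have eq: "T (r *\<^sub>R y) = r *\<^sub>R T y" if y: "0 \<le> y" for r y
    using upper[OF y, of r] upper[OF y, of "- r"] by (intro order.antisym) (simp_all add: neg)
  have "T (r *\<^sub>R x) = T (r *\<^sub>R pprt x - r *\<^sub>R pprt (- x))"
    by (metis eq_pprt_diff scaleR_right_diff_distrib)
  also have "\<dots> = r *\<^sub>R (T (pprt x - pprt (- x)))"
    by (simp only: diff eq zero_le_pprt scaleR_right_diff_distrib)
  finally show ?thesis
    by (simp flip: eq_pprt_diff)
qed

text \<open>Division by \<open>2 * real n\<close> gives the bound with an extra factor 1/2 on both
  terms, which positivity of \<open>e\<close> and \<open>s\<close> allows to drop.\<close>

lemma le_of_square_bound:
  fixes n :: nat and e s x :: "'a::vector_lattice"
  assumes n: "1 \<le> n" and e: "0 \<le> e" and s: "0 \<le> s"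
    and le: "(2 * real n) *\<^sub>R x - (real n)\<^sup>2 *\<^sub>R e \<le> s"
  shows "x \<le> real n *\<^sub>R e + (1 / real n) *\<^sub>R s"
proof -
  have "(1 / (2 * real n)) *\<^sub>R ((2 * real n) *\<^sub>R x) \<le> (1 / (2 * real n)) *\<^sub>R (s + (real n)\<^sup>2 *\<^sub>R e)"
    using le by (intro scaleR_left_mono) (simp_all add: diff_le_eq)
  then have "x \<le> (1 / (2 * real n)) *\<^sub>R s + (real n / 2) *\<^sub>R e"
    using n by (simp add: scaleR_right_distrib power2_eq_square)
  also have "\<dots> \<le> (1 / real n) *\<^sub>R s + real n *\<^sub>R e"
    using n by (intro add_mono scaleR_right_mono s e) (simp_all add: field_simps)
  finally show ?thesis
    by (simp add: add.commute)
qed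

text \<open>Subtracting \<open>inf a b\<close> from \<open>a\<close> and \<open>b\<close> leaves
  disjoint remainders; their images stay disjoint, and adding back \<open>Q (inf a b)\<close> gives
  the claim.\<close>

lemma additive_disjoint_inf:
  fixes Q :: "'a::lattice_ab_group_add \<Rightarrow> 'b::lattice_ab_group_add"
  assumes add: "\<And>x y. Q (x + y) = Q x + Q y"
    and disj: "\<And>p q. inf p q = 0 \<Longrightarrow> inf (Q p) (Q q) = 0"
  shows "Q (inf a b) = inf (Q a) (Q b)"
proof -
  define m where "m = inf a b"
  have "inf (Q (a - m)) (Q (b - m)) = 0"
    unfolding m_def by (intro disj inf_diff_disjoint)
  then have "Q m = Q m + inf (Q (a - m)) (Q (b - m))"
    by simp
  also have "\<dots> = inf (Q (m + (a - m))) (Q (m + (b - m)))"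
    unfolding add by (rule add_inf_distrib_left)
  finally show ?thesis
    by (simp add: m_def del: diff_inf_eq_sup)
qed

section \<open>The approximation argument\<close>

text \<open>One step along the grid: \<open>y\<close> is \<open>x\<close> minus the current grid
  point, and the second argument of \<open>inf\<close> is the distance to the next one. With
  \<open>r = pprt (y - d)\<close> the arguments are at most \<open>d + r + pprt y\<close> and
  \<open>d + r + pprt (- y)\<close>, whose last terms are disjoint.\<close>

lemma grid_step:
  fixes y d :: "'a::lattice_ab_group_add"
  assumes "0 \<le> d"
  shows "inf (d + pprt y) (sup (y - d) (d - y)) \<le> d + pprt (y - d)"
proof -
  let ?r = "pprt (y - d)"
  have "d - y \<le> d + ?r + pprt (- y)"
    using le_pprt[of "- y"] zero_le_pprt[of "y - d"]
    by (metis add.assoc add_left_mono add_increasing diff_conv_add_uminus)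
  moreover have "y - d \<le> d + ?r + pprt (- y)"
    using le_pprt[of "y - d"] assms
    by (metis add_increasing add_increasing2 zero_le_pprt)
  ultimately have "sup (y - d) (d - y) \<le> d + ?r + pprt (- y)"
    by simp
  moreover have "d + pprt y \<le> d + ?r + pprt y"
    by simp
  ultimately have "inf (d + pprt y) (sup (y - d) (d - y))
      \<le> inf (d + ?r + pprt y) (d + ?r + pprt (- y))"
    by (rule inf_mono[rotated])
  also have "\<dots> = d + ?r"
    by (simp add: inf_pprt_pprt_minus flip: add_inf_distrib_left)
  finally show ?thesis .
qed

text \<open>The conditions on \<open>Q\<close> fit sums of orthomorphisms as well as squaring;
  \<open>Q_scaleR\<close> is an inequality because squaring produces the factor
  \<open>1 / n^2\<close>.\<close>

lemma le_zero_if_le_grid: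
  fixes e x w :: "'a::vector_lattice" and v :: "'b::archimedean_vector_lattice"
  assumes e: "0 \<le> e" and x: "0 \<le> x" and w: "0 \<le> w"
    and xw: "\<And>n::nat. 1 \<le> n \<Longrightarrow> x \<le> real n *\<^sub>R e + (1 / real n) *\<^sub>R w"
    and Q_inf: "\<And>a b. 0 \<le> a \<Longrightarrow> 0 \<le> b \<Longrightarrow> Q (inf a b) = inf (Q a) (Q b)"
    and Q_nonneg: "\<And>a. 0 \<le> a \<Longrightarrow> 0 \<le> Q a"
    and Q_scaleR: "\<And>a (n::nat). 0 \<le> a \<Longrightarrow> 1 \<le> n \<Longrightarrow> Q ((1 / real n) *\<^sub>R a) \<le> (1 / real n) *\<^sub>R Q a"
    and v: "\<And>t::real. 0 \<le> t \<Longrightarrow> v \<le> Q (sup (x - t *\<^sub>R e) (t *\<^sub>R e - x))"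
  shows "v \<le> 0"
proof (rule archimedean_le_zero)
  have Q_mono: "Q a \<le> Q b" if "0 \<le> a" "a \<le> b" for a b
    using Q_inf[of a b] that by (metis inf.absorb1 inf_le2 order.trans)
  show "0 \<le> Q (e + w)"
    using e w by (simp add: Q_nonneg)
  fix N :: nat
  assume N: "1 \<le> N"
  \<comment> \<open>The mesh is \<open>e / N\<close>. Each grid point replaces the excess of
    \<open>x\<close> over the previous point by the excess over the new one, at the cost of a single
    \<open>d\<close> throughout.\<close>
  define d where "d = (1 / real N) *\<^sub>R e"
  have d: "0 \<le> d"
    using e by (simp add: d_def scaleR_nonneg_nonneg)
  have grid: "v \<le> Q (d + pprt (x - real n *\<^sub>R d))" for n
  proof (induction n)
    case 0
    have "sup x (- x) = x"
      using x by (simp add: sup_absorb1 minus_le_self_iff)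
    then show ?case
      using v[of 0] Q_mono[of x "d + x"] x d by simp
  next
    case (Suc n)
    let ?y = "x - real n *\<^sub>R d"
    have y: "?y - d = x - (real (Suc n) / real N) *\<^sub>R e" "d - ?y = (real (Suc n) / real N) *\<^sub>R e - x"
      by (simp_all add: d_def algebra_simps add_divide_distrib)
    have nonneg: "0 \<le> sup (?y - d) (d - ?y)"
      using sup_minus_nonneg[of "?y - d"] by simp
    have "v \<le> Q (sup (?y - d) (d - ?y))"
      unfolding y by (rule v) simp
    with Suc have "v \<le> Q (inf (d + pprt ?y) (sup (?y - d) (d - ?y)))"
      using d nonneg by (simp add: Q_inf)
    also have "\<dots> \<le> Q (d + pprt (?y - d))"
      using d nonneg by (intro Q_mono grid_step) simp_all
    also have "?y - d = x - real (Suc n) *\<^sub>R d"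
      by (simp add: algebra_simps)
    finally show ?case .
  qed
  \<comment> \<open>After \<open>N * N\<close> steps the grid reaches \<open>N e\<close>, above
    which \<open>xw\<close> leaves at most \<open>w / N\<close> of \<open>x\<close>.\<close>
  have "real (N * N) *\<^sub>R d = real N *\<^sub>R e"
    using N by (simp add: d_def)
  then have "pprt (x - real (N * N) *\<^sub>R d) \<le> (1 / real N) *\<^sub>R w"
    using xw[OF N] w by (simp add: pprt_def scaleR_nonneg_nonneg algebra_simps)
  then have "d + pprt (x - real (N * N) *\<^sub>R d) \<le> (1 / real N) *\<^sub>R (e + w)"
    by (simp add: d_def scaleR_right_distrib)
  then have "Q (d + pprt (x - real (N * N) *\<^sub>R d)) \<le> Q ((1 / real N) *\<^sub>R (e + w))"
    using d by (intro Q_mono) simp_all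
  also have "\<dots> \<le> (1 / real N) *\<^sub>R Q (e + w)"
    using e w N by (intro Q_scaleR) simp_all
  finally show "v \<le> (1 / real N) *\<^sub>R Q (e + w)"
    using grid[of "N * N"] by (rule order.trans[rotated])
qed

text \<open>The hypotheses make \<open>T\<close> and \<open>S\<close> positive orthomorphisms that
  agree at \<open>e\<close>. They are symmetric in \<open>T\<close> and \<open>S\<close>, so two
  applications give equality at \<open>x\<close>.\<close>

lemma orthomorphism_le:
  fixes T S :: "'a::archimedean_vector_lattice \<Rightarrow> 'a"
  assumes T_add: "\<And>x y. T (x + y) = T x + T y" and S_add: "\<And>x y. S (x + y) = S x + S y"
    and T_pos: "\<And>x. 0 \<le> x \<Longrightarrow> 0 \<le> T x" and S_pos: "\<And>x. 0 \<le> x \<Longrightarrow> 0 \<le> S x"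
    and T_disj: "\<And>p q. inf p q = 0 \<Longrightarrow> inf (T p) q = 0"
    and S_disj: "\<And>p q. inf p q = 0 \<Longrightarrow> inf (S p) q = 0"
    and unit: "T e = S e"
    and e: "0 \<le> e" and x: "0 \<le> x" and w: "0 \<le> w"
    and xw: "\<And>n::nat. 1 \<le> n \<Longrightarrow> x \<le> real n *\<^sub>R e + (1 / real n) *\<^sub>R w"
  shows "T x \<le> S x"
proof -
  define Q where "Q y = T y + S y" for y
  have T_scaleR: "T (r *\<^sub>R y) = r *\<^sub>R T y" and S_scaleR: "S (r *\<^sub>R y) = r *\<^sub>R S y" for r y
    by (rule positive_additive_scaleR; fact)+
  have T_diff: "T (y - z) = T y - T z" and S_diff: "S (y - z) = S y - S z" for y z
    using T_add[of "y - z" z] S_add[of "y - z" z] by simp_all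
  have T_mono: "T y \<le> T z" and S_mono: "S y \<le> S z" if "y \<le> z" for y z
    using T_pos[of "z - y"] S_pos[of "z - y"] that by (simp_all add: T_diff S_diff)
  have Q_disj: "inf (Q p) q = 0" if "inf p q = 0" for p q
    unfolding Q_def using that by (intro disjoint_add T_disj S_disj)
  have "T x - S x \<le> 0"
  proof (rule le_zero_if_le_grid[OF e x w xw, where Q = Q])
    show "Q (inf a b) = inf (Q a) (Q b)" for a b
    proof (rule additive_disjoint_inf)
      \<comment> \<open>Disjointness is preserved in one argument at a time, hence two uses.\<close>
      show "inf (Q p) (Q q) = 0" if "inf p q = 0" for p q
        using Q_disj[OF that] Q_disj[of q "Q p"] by (simp add: inf_commute)
    qed (simp add: Q_def T_add S_add algebra_simps)
    show "0 \<le> Q a" if "0 \<le> a" for a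
      using that by (simp add: Q_def T_pos S_pos)
    show "Q ((1 / real n) *\<^sub>R a) \<le> (1 / real n) *\<^sub>R Q a" for a n
      by (simp only: Q_def T_scaleR S_scaleR scaleR_right_distrib order.refl)
    fix t :: real
    let ?z = "x - t *\<^sub>R e" and ?z' = "t *\<^sub>R e - x"
    \<comment> \<open>The terms in \<open>t\<close> cancel because \<open>T e = S e\<close>; both
      \<open>?z\<close> and \<open>?z'\<close> lie below the modulus of \<open>?z\<close>.\<close>
    have "T x - S x = T ?z + S ?z'"
      by (simp add: T_diff S_diff T_scaleR S_scaleR unit)
    also have "\<dots> \<le> Q (sup ?z ?z')"
      unfolding Q_def by (intro add_mono T_mono S_mono) simp_all
    finally show "T x - S x \<le> Q (sup ?z ?z')" .
  qed
  then show ?thesis by simp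
qed

section \<open>Order-theoretic squares\<close>

lemma has_osquare_iff:
  "has_osquare e f s \<longleftrightarrow> (\<forall>l. (2 * l) *\<^sub>R f - l\<^sup>2 *\<^sub>R e \<le> s) \<and>
     (\<forall>u. (\<forall>l. (2 * l) *\<^sub>R f - l\<^sup>2 *\<^sub>R e \<le> u) \<longrightarrow> s \<le> u)"
  by (auto simp: has_osquare_def isLub_def leastP_def isUb_def setge_def setle_def)

context
  fixes e :: "'a::archimedean_vector_lattice"
  assumes closed: "square_closed e"
begin

lemma has_osquare_osquare: "has_osquare e f (osquare e f)"
  using closed osquare_eq unfolding square_closed_def by metis

lemma osquare_upper: "(2 * l) *\<^sub>R f - l\<^sup>2 *\<^sub>R e \<le> osquare e f"
  using has_osquare_osquare[of f] by (simp add: has_osquare_iff)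

lemma osquare_least: "(\<And>l. (2 * l) *\<^sub>R f - l\<^sup>2 *\<^sub>R e \<le> u) \<Longrightarrow> osquare e f \<le> u"
  using has_osquare_osquare[of f] by (simp add: has_osquare_iff)

lemma osquare_eqI:
  assumes "\<And>l. (2 * l) *\<^sub>R f - l\<^sup>2 *\<^sub>R e \<le> s"
    and "\<And>u. (\<And>l. (2 * l) *\<^sub>R f - l\<^sup>2 *\<^sub>R e \<le> u) \<Longrightarrow> s \<le> u"
  shows "osquare e f = s"
  using assms by (intro osquare_eq) (simp add: has_osquare_iff)

lemma osquare_nonneg: "0 \<le> osquare e f"
  using osquare_upper[of 0 f] by simp

text \<open>For \<open>f = 0\<close> and \<open>l = sqrt n\<close> the defining family contains
  \<open>- n e\<close>, so \<open>- e\<close> is at most \<open>1 / n\<close> times the square of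
  0.\<close>

lemma unit_nonneg: "0 \<le> e"
proof -
  have "- e \<le> 0"
  proof (rule archimedean_le_zero)
    show "0 \<le> osquare e 0" by (rule osquare_nonneg)
    fix n :: nat
    assume n: "1 \<le> n"
    let ?l = "sqrt (real n)"
    have "- (real n *\<^sub>R e) \<le> osquare e 0"
      using osquare_upper[of ?l 0] by simp
    then have "(1 / real n) *\<^sub>R (- (real n *\<^sub>R e)) \<le> (1 / real n) *\<^sub>R osquare e 0"
      by (rule scaleR_left_mono) simp
    then show "- e \<le> (1 / real n) *\<^sub>R osquare e 0"
      using n by simp
  qed
  then show ?thesis by simp
qed

lemma osquare_unit: "osquare e e = e"
proof (rule osquare_eqI)
  fix l :: real
  have "2 * l - l\<^sup>2 \<le> 1"
    using zero_le_power2[of "l - 1"] by (simp add: power2_eq_square algebra_simps)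
  then have "(2 * l - l\<^sup>2) *\<^sub>R e \<le> 1 *\<^sub>R e"
    using unit_nonneg by (rule scaleR_right_mono)
  then show "(2 * l) *\<^sub>R e - l\<^sup>2 *\<^sub>R e \<le> e"
    by (simp add: scaleR_left_diff_distrib)
next
  show "e \<le> u" if "\<And>l. (2 * l) *\<^sub>R e - l\<^sup>2 *\<^sub>R e \<le> u" for u
    using that[of 1] by (simp add: scaleR_2)
qed

text \<open>The hypotheses say |x| \<le> y; the term of \<open>x\<close> at \<open>l\<close> is
  dominated by the term of \<open>y\<close> at |l|.\<close>

lemma osquare_mono_abs:
  assumes "x \<le> y" "- x \<le> y"
  shows "osquare e x \<le> osquare e y"
proof (rule osquare_least)
  fix l :: real
  have "(2 * l) *\<^sub>R x \<le> (2 * \<bar>l\<bar>) *\<^sub>R y"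
  proof (cases "0 \<le> l")
    case True
    then show ?thesis using assms(1) by (simp add: scaleR_left_mono)
  next
    case False
    then have "(2 * \<bar>l\<bar>) *\<^sub>R (- x) \<le> (2 * \<bar>l\<bar>) *\<^sub>R y"
      using assms(2) by (intro scaleR_left_mono) simp_all
    then show ?thesis using False by simp
  qed
  then show "(2 * l) *\<^sub>R x - l\<^sup>2 *\<^sub>R e \<le> osquare e y"
    using osquare_upper[of "\<bar>l\<bar>" y] by (simp add: algebra_simps order.trans)
qed

lemma osquare_minus: "osquare e (- x) = osquare e x"
proof -
  have le: "osquare e (- y) \<le> osquare e y" for y
  proof (rule osquare_least)
    show "(2 * l) *\<^sub>R (- y) - l\<^sup>2 *\<^sub>R e \<le> osquare e y" for l
      using osquare_upper[of "- l" y] by simp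
  qed
  show ?thesis
    using le[of x] le[of "- x"] by simp
qed

lemma osquare_parallelogram:
  "osquare e (f + g) + osquare e (f - g) = 2 *\<^sub>R osquare e f + 2 *\<^sub>R osquare e g"
proof (rule order.antisym)
  let ?p = "\<lambda>l x. (2 * l) *\<^sub>R x - l\<^sup>2 *\<^sub>R e"
  \<comment> \<open>The change of parameters is invertible over the reals, so this identity serves
    both inequalities.\<close>
  have subst: "?p (a + b) (f + g) + ?p (a - b) (f - g) = 2 *\<^sub>R ?p a f + 2 *\<^sub>R ?p b g" for a b
  proof -
    have "?p (a + b) (f + g) + ?p (a - b) (f - g)
        = (4 * a) *\<^sub>R f + (4 * b) *\<^sub>R g - ((a + b)\<^sup>2 + (a - b)\<^sup>2) *\<^sub>R e"
      by (simp add: algebra_simps flip: scaleR_left_distrib)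
         (simp add: algebra_simps flip: scaleR_left_distrib add.assoc)
    also have "(a + b)\<^sup>2 + (a - b)\<^sup>2 = 2 * a\<^sup>2 + 2 * b\<^sup>2"
      by (simp add: power2_eq_square algebra_simps)
    finally show ?thesis
      by (simp add: algebra_simps)
  qed
  show "osquare e (f + g) + osquare e (f - g) \<le> 2 *\<^sub>R osquare e f + 2 *\<^sub>R osquare e g" (is "_ \<le> ?R")
  proof -
    have *: "?p l (f + g) + ?p m (f - g) \<le> ?R" for l m
    proof -
      have "?p l (f + g) + ?p m (f - g) = 2 *\<^sub>R ?p ((l + m) / 2) f + 2 *\<^sub>R ?p ((l - m) / 2) g"
        using subst[of "(l + m) / 2" "(l - m) / 2"] by (simp add: field_simps)
      also have "\<dots> \<le> ?R"
        by (intro add_mono scaleR_left_mono osquare_upper) simp_all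
      finally show ?thesis .
    qed
    \<comment> \<open>The suprema are taken in turn: over the first parameter with \<open>m\<close>
      fixed, then over \<open>m\<close>.\<close>
    have "osquare e (f + g) \<le> ?R - ?p m (f - g)" for m
      by (rule osquare_least) (use *[of _ m] in \<open>simp add: le_diff_eq\<close>)
    then have "osquare e (f - g) \<le> ?R - osquare e (f + g)"
      by (intro osquare_least) (metis add.commute le_diff_eq)
    then show ?thesis
      by (simp add: le_diff_eq add.commute)
  qed
  show "?R \<le> osquare e (f + g) + osquare e (f - g)" (is "_ \<le> ?L")
  proof -
    have *: "2 *\<^sub>R ?p a f + 2 *\<^sub>R ?p b g \<le> ?L" for a b
      unfolding subst[symmetric] by (intro add_mono osquare_upper)
    have *: "?p a f + ?p b g \<le> (1/2) *\<^sub>R ?L" for a b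
      using scaleR_left_mono[OF *[of a b], of "1/2"] by (simp add: scaleR_right_distrib)
    have "osquare e f \<le> (1/2) *\<^sub>R ?L - ?p b g" for b
      by (rule osquare_least) (use *[of _ b] in \<open>simp add: le_diff_eq\<close>)
    then have "osquare e g \<le> (1/2) *\<^sub>R ?L - osquare e f"
      by (intro osquare_least) (metis add.commute le_diff_eq)
    then have "osquare e f + osquare e g \<le> (1/2) *\<^sub>R ?L"
      by (simp add: le_diff_eq add.commute)
    from scaleR_left_mono[OF this, of 2] show ?thesis
      by (simp add: scaleR_right_distrib)
  qed
qed

section \<open>The polarised product\<close>

lemma osprod_commute: "osprod e f g = osprod e g f"
  by (simp add: osprod_def add.commute)

text \<open>The Jordan-von Neumann argument: three parallelogram laws are combined with signs so
  that the mixed squares cancel, using that the square is even; a fourth eliminates the square of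
  \<open>f - g\<close>.\<close>

lemma osprod_add_left: "osprod e (f + g) h = osprod e f h + osprod e g h"
proof -
  let ?q = "osquare e"
  have "?q ((f + h) + g) + ?q ((f + h) - g) = 2 *\<^sub>R ?q (f + h) + 2 *\<^sub>R ?q g"
    "?q ((g + h) + f) + ?q ((g + h) - f) = 2 *\<^sub>R ?q (g + h) + 2 *\<^sub>R ?q f"
    "?q ((f - g) + h) + ?q ((f - g) - h) = 2 *\<^sub>R ?q (f - g) + 2 *\<^sub>R ?q h"
    "?q (f + g) + ?q (f - g) = 2 *\<^sub>R ?q f + 2 *\<^sub>R ?q g"
    by (rule osquare_parallelogram)+
  then have parallelogram:
    "?q (f + g + h) + ?q (f - g + h) = 2 *\<^sub>R ?q (f + h) + 2 *\<^sub>R ?q g"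
    "?q (f + g + h) + ?q (g + h - f) = 2 *\<^sub>R ?q (g + h) + 2 *\<^sub>R ?q f"
    "?q (f - g + h) + ?q (f - g - h) = 2 *\<^sub>R ?q (f - g) + 2 *\<^sub>R ?q h"
    "?q (f - g) = 2 *\<^sub>R ?q f + 2 *\<^sub>R ?q g - ?q (f + g)"
    by (simp_all add: algebra_simps)
  have "?q (g + h - f) = ?q (f - g - h)"
    using osquare_minus[of "g + h - f"] by (simp add: algebra_simps)
  then have "2 *\<^sub>R ?q (f + g + h) = (?q (f + g + h) + ?q (f - g + h))
      + (?q (f + g + h) + ?q (g + h - f)) - (?q (f - g + h) + ?q (f - g - h))"
    by (simp add: scaleR_2)
  also have "\<dots> = 2 *\<^sub>R (?q (f + h) + ?q (g + h) + ?q (f + g) - ?q f - ?q g - ?q h)"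
    unfolding parallelogram by (simp add: scaleR_2 algebra_simps)
  finally have "2 *\<^sub>R ?q (f + g + h)
      = 2 *\<^sub>R (?q (f + h) + ?q (g + h) + ?q (f + g) - ?q f - ?q g - ?q h)" .
  then have "?q (f + g + h) = ?q (f + h) + ?q (g + h) + ?q (f + g) - ?q f - ?q g - ?q h"
    by simp
  then have "?q (f + g + h) - (?q (f + g) + ?q h)
      = (?q (f + h) - (?q f + ?q h)) + (?q (g + h) - (?q g + ?q h))"
    by (simp add: algebra_simps)
  then show ?thesis
    by (simp only: osprod_def scaleR_right_distrib)
qed

lemma osprod_add_right: "osprod e f (g + h) = osprod e f g + osprod e f h"
  using osprod_add_left[of g h f] by (simp add: osprod_commute)

text \<open>From |f - g| \<le> f + g the square of \<open>f - g\<close> is at most that of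
  \<open>f + g\<close>; the parallelogram law converts this into the claim.\<close>

lemma osprod_nonneg:
  assumes "0 \<le> f" "0 \<le> g"
  shows "0 \<le> osprod e f g"
proof -
  have "f - g \<le> f + g" "- (f - g) \<le> f + g"
    using assms by (simp_all add: diff_le_eq add.assoc add_increasing2 minus_le_self_iff)
  then have "osquare e (f - g) \<le> osquare e (f + g)"
    by (rule osquare_mono_abs)
  then have "2 *\<^sub>R (osquare e f + osquare e g) \<le> 2 *\<^sub>R osquare e (f + g)"
    by (simp add: scaleR_right_distrib flip: osquare_parallelogram) (simp add: scaleR_2)
  from scaleR_left_mono[OF this, of "1/2"] have "osquare e f + osquare e g \<le> osquare e (f + g)"
    by simp
  then show ?thesis
    by (simp add: osprod_def scaleR_nonneg_nonneg)
qed

lemma osprod_scaleR_left: "osprod e (r *\<^sub>R f) g = r *\<^sub>R osprod e f g"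
proof -
  have pos: "osprod e (r *\<^sub>R f) h = r *\<^sub>R osprod e f h" if "0 \<le> h" for h
    using that by (intro positive_additive_scaleR) (simp_all add: osprod_add_left osprod_nonneg)
  have diff: "osprod e a (b - c) = osprod e a b - osprod e a c" for a b c
    using osprod_add_right[of a "b - c" c] by simp
  have "osprod e (r *\<^sub>R f) (pprt g - pprt (- g)) = r *\<^sub>R osprod e f (pprt g - pprt (- g))"
    by (simp only: diff pos zero_le_pprt scaleR_right_diff_distrib)
  then show ?thesis
    by (simp flip: eq_pprt_diff)
qed

text \<open>Shifting \<open>l\<close> to \<open>l - 1\<close> identifies the family of
  \<open>f + e\<close> with that of \<open>f\<close> translated by \<open>2 f + e\<close>.\<close>

lemma osprod_unit: "osprod e f e = f"
proof -
  have "osquare e (f + e) = osquare e f + 2 *\<^sub>R f + e"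
  proof (rule osquare_eqI)
    have shift: "(2 * l) *\<^sub>R (f + e) - l\<^sup>2 *\<^sub>R e
        = (2 * (l - 1)) *\<^sub>R f - (l - 1)\<^sup>2 *\<^sub>R e + (2 *\<^sub>R f + e)" for l
      by (simp add: power2_eq_square algebra_simps)
    show "(2 * l) *\<^sub>R (f + e) - l\<^sup>2 *\<^sub>R e \<le> osquare e f + 2 *\<^sub>R f + e" for l
      unfolding shift using osquare_upper[of "l - 1" f] by (simp add: add.assoc)
    fix u
    assume u: "\<And>l. (2 * l) *\<^sub>R (f + e) - l\<^sup>2 *\<^sub>R e \<le> u"
    have "osquare e f \<le> u - (2 *\<^sub>R f + e)"
      by (rule osquare_least) (use u shift in \<open>metis add_diff_cancel_right' le_diff_eq\<close>)
    then show "osquare e f + 2 *\<^sub>R f + e \<le> u"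
      by (simp add: le_diff_eq add.assoc)
  qed
  then show ?thesis
    by (simp add: osprod_def osquare_unit)
qed

lemma osprod_mono_left:
  assumes "f \<le> g" "0 \<le> h"
  shows "osprod e f h \<le> osprod e g h"
  using osprod_nonneg[of "g - f" h] osprod_add_left[of "g - f" f h] assms by simp

lemma le_unit_plus_osquare:
  fixes n :: nat
  assumes "1 \<le> n"
  shows "c \<le> real n *\<^sub>R e + (1 / real n) *\<^sub>R osquare e c"
  using osquare_upper[of "real n" c] by (rule le_of_square_bound[OF assms unit_nonneg osquare_nonneg])

text \<open>Splitting the bound on \<open>c\<close>, the part \<open>n e\<close> contributes
  \<open>n f\<close>, still disjoint from \<open>g\<close>, and the rest contributes
  \<open>1 / n\<close> times a fixed element.\<close>

lemma osprod_disjoint: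
  assumes fg: "inf f g = 0" and c: "0 \<le> c"
  shows "inf (osprod e c f) g = 0"
proof (rule order.antisym)
  have f: "0 \<le> f" and g: "0 \<le> g"
    using disjoint_nonneg[OF fg] .
  let ?s = "osprod e (osquare e c) f"
  have s: "0 \<le> ?s"
    by (intro osprod_nonneg osquare_nonneg f)
  show "0 \<le> inf (osprod e c f) g"
    using f g c by (simp add: osprod_nonneg)
  show "inf (osprod e c f) g \<le> 0"
  proof (rule archimedean_le_zero[OF s])
    fix n :: nat
    assume n: "1 \<le> n"
    let ?a = "real n *\<^sub>R f" and ?b = "(1 / real n) *\<^sub>R ?s"
    have "osprod e c f \<le> osprod e (real n *\<^sub>R e + (1 / real n) *\<^sub>R osquare e c) f"
      using le_unit_plus_osquare[OF n] f by (rule osprod_mono_left)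
    also have "\<dots> = ?a + ?b"
      using osprod_unit[of f] by (simp add: osprod_add_left osprod_scaleR_left osprod_commute[of e])
    finally have "inf (osprod e c f) g \<le> inf (?a + ?b) g"
      by (rule inf_mono) simp
    also have "\<dots> \<le> inf ?a g + inf ?b g"
      using f g s by (intro inf_add_le) (simp_all add: scaleR_nonneg_nonneg)
    also have "inf ?a g = 0"
      using fg by (rule disjoint_scaleR_left) simp
    finally show "inf (osprod e c f) g \<le> ?b"
      by (simp add: order.trans)
  qed
qed

text \<open>Both sides are orthomorphisms in \<open>h\<close>, and both send \<open>e\<close> to
  \<open>osprod e f g\<close>.\<close>

lemma osprod_assoc_nonneg:
  assumes "0 \<le> f" "0 \<le> g" "0 \<le> h"
  shows "osprod e (osprod e f g) h = osprod e f (osprod e g h)"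
proof -
  let ?T = "\<lambda>x. osprod e f (osprod e g x)" and ?S = "\<lambda>x. osprod e (osprod e f g) x"
  have T_add: "?T (x + y) = ?T x + ?T y" and S_add: "?S (x + y) = ?S x + ?S y" for x y
    by (simp_all add: osprod_add_right)
  have T_pos: "0 \<le> ?T x" and S_pos: "0 \<le> ?S x" if "0 \<le> x" for x
    using assms that by (simp_all add: osprod_nonneg)
  have T_disj: "inf (?T p) q = 0" and S_disj: "inf (?S p) q = 0" if "inf p q = 0" for p q
    using assms that by (simp_all add: osprod_disjoint osprod_nonneg)
  have unit: "?T e = ?S e"
    by (simp add: osprod_unit)
  show ?thesis
  proof (rule order.antisym)
    show "?T h \<le> ?S h"
      by (rule orthomorphism_le[OF T_add S_add T_pos S_pos T_disj S_disj unit unit_nonneg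
            assms(3) osquare_nonneg le_unit_plus_osquare])
    show "?S h \<le> ?T h"
      by (rule orthomorphism_le[OF S_add T_add S_pos T_pos S_disj T_disj unit[symmetric] unit_nonneg
            assms(3) osquare_nonneg le_unit_plus_osquare])
  qed
qed

lemma osprod_assoc: "osprod e (osprod e f g) h = osprod e f (osprod e g h)"
proof -
  have diff_left: "osprod e (a - b) c = osprod e a c - osprod e b c" for a b c
    using osprod_add_left[of "a - b" b c] by simp
  have diff_right: "osprod e a (b - c) = osprod e a b - osprod e a c" for a b c
    using osprod_add_right[of a "b - c" c] by simp
  have "osprod e (osprod e (pprt f - pprt (- f)) (pprt g - pprt (- g))) (pprt h - pprt (- h))
      = osprod e (pprt f - pprt (- f)) (osprod e (pprt g - pprt (- g)) (pprt h - pprt (- h)))"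
    by (simp only: diff_left diff_right osprod_assoc_nonneg zero_le_pprt)
  then show ?thesis
    by (simp flip: eq_pprt_diff)
qed

lemma phi_algebra_osprod: "phi_algebra (osprod e) e"
proof
  show "osprod e (a *\<^sub>R f) (b *\<^sub>R g) = (a * b) *\<^sub>R osprod e f g" for a f b g
    by (metis osprod_scaleR_left osprod_commute scaleR_scaleR)
  show "inf (osprod e f c) g = 0" if "inf f g = 0" "0 \<le> c" for f g c
    using osprod_disjoint[OF that] by (simp add: osprod_commute)
  show "osprod e e f = f" for f
    using osprod_unit[of f] by (simp add: osprod_commute)
qed (fact osprod_add_right osprod_add_left osprod_assoc osprod_nonneg osprod_disjoint osprod_unit)+

end

section \<open>Squares in \<open>\<Phi>\<close>-algebras\<close>

context phi_algebra
begin

section \<open>Algebraic rules and squares of moduli and infima\<close>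

lemma diff_left: "(f - g) \<odot> h = f \<odot> h - g \<odot> h"
  using distrib_right[of "f - g" g h] by simp

lemma diff_right: "f \<odot> (g - h) = f \<odot> g - f \<odot> h"
  using distrib_left[of f "g - h" h] by simp

lemma scaleR_left: "(a *\<^sub>R f) \<odot> g = a *\<^sub>R (f \<odot> g)"
  using scaleR_mult[of a f 1 g] by simp

lemma scaleR_right: "f \<odot> (a *\<^sub>R g) = a *\<^sub>R (f \<odot> g)"
  using scaleR_mult[of 1 f a g] by simp

text \<open>Multiplying \<open>f\<close> by \<open>g\<close> on the right makes the product disjoint
  from \<open>g\<close>; multiplying that \<open>g\<close> by \<open>f\<close> on the left makes the
  product disjoint from itself.\<close>

lemma disjoint_mult_zero:
  assumes "inf f g = 0"
  shows "f \<odot> g = 0"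
proof -
  note nonneg = disjoint_nonneg[OF assms]
  have "inf g (f \<odot> g) = 0"
    using mult_right_disjoint[OF assms nonneg(2)] by (simp add: inf_commute)
  from mult_left_disjoint[OF this nonneg(1)] show ?thesis
    by simp
qed

lemma square_pprt_add_diff:
  "(pprt f - pprt (- f)) \<odot> (pprt f - pprt (- f)) = pprt f \<odot> pprt f + pprt (- f) \<odot> pprt (- f)"
  "(pprt f + pprt (- f)) \<odot> (pprt f + pprt (- f)) = pprt f \<odot> pprt f + pprt (- f) \<odot> pprt (- f)"
proof -
  have "pprt f \<odot> pprt (- f) = 0" "pprt (- f) \<odot> pprt f = 0"
    using inf_pprt_pprt_minus[of f] by (simp_all add: disjoint_mult_zero inf_commute)
  then show
    "(pprt f - pprt (- f)) \<odot> (pprt f - pprt (- f)) = pprt f \<odot> pprt f + pprt (- f) \<odot> pprt (- f)"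
    "(pprt f + pprt (- f)) \<odot> (pprt f + pprt (- f)) = pprt f \<odot> pprt f + pprt (- f) \<odot> pprt (- f)"
    by (simp_all add: diff_left diff_right distrib_left distrib_right)
qed

lemma square_sup_minus: "sup f (- f) \<odot> sup f (- f) = f \<odot> f"
  using square_pprt_add_diff[of f] by (simp add: sup_minus_eq_pprt flip: eq_pprt_diff)

lemma square_nonneg: "0 \<le> f \<odot> f"
  using square_pprt_add_diff(1)[of f] by (simp add: mult_nonneg flip: eq_pprt_diff)

lemma square_diff_unit: "(f - t *\<^sub>R e) \<odot> (f - t *\<^sub>R e) = f \<odot> f - (2 * t) *\<^sub>R f + t\<^sup>2 *\<^sub>R e"
proof -
  have "(2 * t) *\<^sub>R f = t *\<^sub>R f + t *\<^sub>R f"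
    by (simp flip: scaleR_left_distrib)
  then show ?thesis
    by (simp add: diff_left diff_right scaleR_left scaleR_right unit_left unit_right
        power2_eq_square algebra_simps)
qed

text \<open>With \<open>m = inf a b\<close>, both squares are \<open>m\<close> squared plus a
  remainder; the remainders inherit disjointness from \<open>p\<close> and \<open>q\<close>.\<close>

lemma square_inf:
  assumes "0 \<le> a" "0 \<le> b"
  shows "inf a b \<odot> inf a b = inf (a \<odot> a) (b \<odot> b)"
proof -
  define m p q where "m = inf a b" and "p = a - m" and "q = b - m"
  have a: "a = m + p" and b: "b = m + q"
    by (simp_all add: p_def q_def)
  have m: "0 \<le> m"
    using assms by (simp add: m_def)
  have pq: "inf p q = 0"
    unfolding p_def q_def m_def by (rule inf_diff_disjoint)
  \<comment> \<open>Applied once for each of \<open>p\<close> and \<open>q\<close>, with the roles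
    exchanged in between.\<close>
  have disj: "inf (m \<odot> r + r \<odot> m + r \<odot> r) s = 0" if "inf r s = 0" for r s
    using that m disjoint_nonneg(1)[OF that]
    by (intro disjoint_add mult_left_disjoint mult_right_disjoint)
  have "inf (m \<odot> p + p \<odot> m + p \<odot> p) (m \<odot> q + q \<odot> m + q \<odot> q) = 0"
    using disj[OF disj[OF pq, unfolded inf_commute[of _ q]]] by (simp add: inf_commute)
  then have "m \<odot> m = inf (m \<odot> m + (m \<odot> p + p \<odot> m + p \<odot> p)) (m \<odot> m + (m \<odot> q + q \<odot> m + q \<odot> q))"
    by (simp flip: add_inf_distrib_left)
  also have "\<dots> = inf (a \<odot> a) (b \<odot> b)"
    by (simp add: a b distrib_left distrib_right add.assoc add.left_commute)
  finally show ?thesis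
    by (simp add: m_def)
qed

end

text \<open>The upper bound is positivity of the square of \<open>f - t e\<close>. For leastness the
  grid argument is run on x = |f|, which has the same square as \<open>f\<close>, with
  \<open>w\<close> the square of \<open>x\<close>.\<close>

lemma phi_algebra_has_osquare:
  fixes e :: "'a::archimedean_vector_lattice" and mult (infixl \<open>\<odot>\<close> 70)
  assumes "phi_algebra mult e"
  shows "has_osquare e f (f \<odot> f)"
proof -
  interpret phi_algebra mult e by fact
  have upper: "(2 * t) *\<^sub>R g - t\<^sup>2 *\<^sub>R e \<le> g \<odot> g" for t g
    using square_nonneg[of "g - t *\<^sub>R e"] by (simp add: square_diff_unit algebra_simps)
  have e: "0 \<le> e"
    using square_nonneg[of e] by (simp add: unit_left)
  have least: "f \<odot> f \<le> u" if u: "\<And>t. (2 * t) *\<^sub>R f - t\<^sup>2 *\<^sub>R e \<le> u" for u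
  proof -
    define x where "x = sup f (- f)"
    have x: "0 \<le> x"
      unfolding x_def by (rule sup_minus_nonneg)
    have "f \<odot> f - u \<le> 0"
    proof (rule le_zero_if_le_grid[OF e x square_nonneg, where Q = "\<lambda>y. y \<odot> y"])
      show "x \<le> real n *\<^sub>R e + (1 / real n) *\<^sub>R (x \<odot> x)" if n: "1 \<le> n" for n
        using upper[of "real n" x] by (rule le_of_square_bound[OF n e square_nonneg])
      show "inf a b \<odot> inf a b = inf (a \<odot> a) (b \<odot> b)" if "0 \<le> a" "0 \<le> b" for a b
        using that by (rule square_inf)
      show "0 \<le> a \<odot> a" for a
        by (rule square_nonneg)
      show "((1 / real n) *\<^sub>R a) \<odot> ((1 / real n) *\<^sub>R a) \<le> (1 / real n) *\<^sub>R (a \<odot> a)"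
        if "1 \<le> n" for a n
        unfolding scaleR_mult using that
        by (intro scaleR_right_mono square_nonneg) (simp add: field_simps)
      fix t :: real
      assume t: "0 \<le> t"
      \<comment> \<open>The parameters \<open>t\<close> and \<open>- t\<close> bound
        \<open>f\<close> and \<open>- f\<close>, hence |f| after division by \<open>2 * t\<close>;
        at \<open>t = 0\<close> the claim is \<open>0 \<le> u\<close>.\<close>
      have "(2 * t) *\<^sub>R x \<le> u + t\<^sup>2 *\<^sub>R e"
      proof (cases "t = 0")
        case True
        then show ?thesis using u[of 0] by simp
      next
        case False
        have "(2 * t) *\<^sub>R f \<le> u + t\<^sup>2 *\<^sub>R e" "(2 * t) *\<^sub>R (- f) \<le> u + t\<^sup>2 *\<^sub>R e"
          using u[of t] u[of "- t"] by (simp_all add: diff_le_eq)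
        then have "(1 / (2 * t)) *\<^sub>R ((2 * t) *\<^sub>R f) \<le> (1 / (2 * t)) *\<^sub>R (u + t\<^sup>2 *\<^sub>R e)"
          "(1 / (2 * t)) *\<^sub>R ((2 * t) *\<^sub>R (- f)) \<le> (1 / (2 * t)) *\<^sub>R (u + t\<^sup>2 *\<^sub>R e)"
          using t by (auto intro: scaleR_left_mono simp del: scaleR_scaleR scaleR_minus_right)
        then have "x \<le> (1 / (2 * t)) *\<^sub>R (u + t\<^sup>2 *\<^sub>R e)"
          using False by (simp add: x_def)
        then have "(2 * t) *\<^sub>R x \<le> (2 * t) *\<^sub>R ((1 / (2 * t)) *\<^sub>R (u + t\<^sup>2 *\<^sub>R e))"
          using t by (intro scaleR_left_mono) simp_all
        then show ?thesis
          using False by simp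
      qed
      then have "f \<odot> f - u \<le> x \<odot> x - (2 * t) *\<^sub>R x + t\<^sup>2 *\<^sub>R e"
        by (simp add: x_def square_sup_minus algebra_simps)
      also have "\<dots> = sup (x - t *\<^sub>R e) (t *\<^sub>R e - x) \<odot> sup (x - t *\<^sub>R e) (t *\<^sub>R e - x)"
        using square_sup_minus[of "x - t *\<^sub>R e"] by (simp add: square_diff_unit)
      finally show "f \<odot> f - u \<le> \<dots>" .
    qed
    then show ?thesis by simp
  qed
  show ?thesis
    using upper least by (simp add: has_osquare_iff)
qed

theorem theorem4p10:
  fixes e :: "'a::archimedean_vector_lattice"
  shows "(square_closed e \<longleftrightarrow> (\<exists>mult. phi_algebra mult e))
    \<and> (square_closed e \<longrightarrow> phi_algebra (osprod e) e)
    \<and> (\<forall>mult. phi_algebra mult e \<longrightarrow> square_closed e)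
    \<and> (\<forall>mult. phi_algebra mult e \<longrightarrow> (\<forall>f. mult f f = osquare e f))"
  using phi_algebra_osprod phi_algebra_has_osquare osquare_eq
  unfolding square_closed_def by metis

end
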